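(* For all finite sequences $\Gamma,\Delta$ of formulas in $\mathrm{Form}$: if $\Gamma\vdash_{\mathbf{SF}}\Delta$, then $\Gamma\models^V_{\mathcal W}\Delta$.
   Context: Formulas: $\mathrm{Var}$ is a countable set of variables; $\mathrm{Form}$ is generated from $\bot$ and $\mathrm{Var}$ by $\land,\lor,\to$; $\neg A$ abbreviates $A\to\bot$. Strict finitistic models: an intuitionistic frame $\langle K,\le\rangle$ is a nonempty partially ordered set; all frames are rooted and tree-like (there is a least element $r$, and for each $k$ the set $\{l: l\le k\}$ is a finite chain). An intuitionistic model $\langle K,\le,v\rangle$ adds $v:\mathrm{Var}\to\mathcal P(K)$ with each $v(p)$ closed upwards. It is a strict finitistic model if (1) the frame is finitely branching; (2) each branch has at most countable length; (3) for each $k\in K$, $\{p\in\mathrm{Var}: k\in v(p)\}$ is finite; (4) for every $p$, if $k\in v(p)$ for some $k$, then for every $l\in K$ there is $l'\ge l$ with $l'\in v(p)$. $\mathcal W$ is the class of all strict finitistic models (finite and infinite). Forcing in $W=\langle K,\le,v\rangle\in\mathcal W$: $k\models_W p$ iff $k\in v(p)$; $k\not\models_W\bot$; $k\models_W A\land B$ iff $k\models_W A$ and $k\models_W B$; $k\models_W A\lor B$ iff $k\models_W A$ or $k\models_W B$; $k\models_W A\to B$ iff for every $k'\ge k$ with $k'\models_W A$ there is $k''\ge k'$ with $k''\models_W B$. For finite $\Gamma,\Delta$ (sequences being read as the sets of their members), $\Gamma\models^V_W\Delta$ means: for every $k\in K$, if $k\models_W A$ for all $A\in\Gamma$, then $k\models_W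 B$ for some $B\in\Delta$. $\Gamma\models^V_{\mathcal W}\Delta$ means $\Gamma\models^V_W\Delta$ for all $W\in\mathcal W$. Sequent calculus $\mathbf{SF}$: sequents are $\Gamma\vdash\Delta$ with $\Gamma,\Delta$ finite sequences of formulas; $\neg\neg\Gamma$ denotes the result of replacing each member $A$ by $\neg\neg A$. Initial sequents: $\bot\vdash$ and $p\vdash p$ for $p\in\mathrm{Var}$. Structural rules: those of Gentzen's classical calculus $\mathbf{LK}$ (weakening, contraction, exchange on both sides, and cut). Logical rules: ($\land$L) from $A,\Gamma\vdash\Delta$ infer $B\land A,\Gamma\vdash\Delta$; from $A,\Gamma\vdash\Delta$ infer $A\land B,\Gamma\vdash\Delta$. ($\land$R) from $\Gamma\vdash\Delta,A$ and $\Gamma\vdash\Delta,B$ infer $\Gamma\vdash\Delta,A\land B$. ($\lor$L) from $A,\Gamma\vdash\Delta$ and $B,\Gamma\vdash\Delta$ infer $A\lor B,\Gamma\vdash\Delta$. ($\lor$R) from $\Gamma\vdash\Delta,A$ infer $\Gamma\vdash\Delta,A\lor B$; from $\Gamma\vdash\Delta,A$ infer $\Gamma\vdash\Delta,B\lor A$. ($\to$L) from $\Gamma\vdash\Delta,A$ and $B,\Pi\vdash\Sigma$ infer $\Gamma,A\to B,\Pi\vdash\Delta,\neg\neg\Sigma$. ($\to$R) from $\Gamma,A\vdash\neg\neg B,\Delta$ infer $\Gamma\vdash A\to B,\neg\neg\Delta$. $\Gamma\vdash_{\mathbf{SF}}\Delta$ means that $\Gamma\vdash\Delta$ is derivable in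 $\mathbf{SF}$. *)

theory Defs
  imports "HOL-Library.Countable_Set"
begin

section \<open>Formulas\<close>

text \<open>
  The type variable \<open>'p\<close> plays the role of the set of propositional variables; it is constrained to
  class \<open>countable\<close> in the consequence relations below.
\<close>

datatype 'p form =
    Bot  ("\<^bold>\<bottom>")
  | Var 'p
  | Conj "'p form" "'p form"  (infixr "\<^bold>\<and>" 70)
  | Disj "'p form" "'p form"  (infixr "\<^bold>\<or>" 65)
  | Imp "'p form" "'p form"  (infixr "\<^bold>\<rightarrow>" 60)

abbreviation Neg :: "'p form \<Rightarrow> 'p form"  ("\<^bold>\<not> _" [80] 80) where
  "\<^bold>\<not> A \<equiv> A \<^bold>\<rightarrow> \<^bold>\<bottom>"

abbreviation NegNeg :: "'p form \<Rightarrow> 'p form"  ("\<^bold>\<not>\<^bold>\<not> _" [80] 80) where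
  "\<^bold>\<not>\<^bold>\<not> A \<equiv> \<^bold>\<not> (\<^bold>\<not> A)"


section \<open>Strict finitistic models\<close>

record ('k, 'p) model =
  nodes :: "'k set"
  le :: "'k rel"
  val :: "'p \<Rightarrow> 'k set"

text \<open>\<^const>\<open>partial_order_on\<close> includes the requirement that the relation lives on the carrier.\<close>

definition rooted :: "'k set \<Rightarrow> 'k rel \<Rightarrow> bool" where
  "rooted K R \<longleftrightarrow> (\<exists>r\<in>K. \<forall>k\<in>K. (r, k) \<in> R)"

definition tree_like :: "'k set \<Rightarrow> 'k rel \<Rightarrow> bool" where
  "tree_like K R \<longleftrightarrow>
     (\<forall>k\<in>K. finite {l\<in>K. (l, k) \<in> R} \<and>
            pred_on.chain K (\<lambda>x y. (x, y) \<in> R) {l\<in>K. (l, k) \<in> R})"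

definition int_frame :: "'k set \<Rightarrow> 'k rel \<Rightarrow> bool" where
  "int_frame K R \<longleftrightarrow> K \<noteq> {} \<and> partial_order_on K R \<and> rooted K R \<and> tree_like K R"

definition int_model :: "('k, 'p) model \<Rightarrow> bool" where
  "int_model W \<longleftrightarrow> int_frame (nodes W) (le W) \<and>
     (\<forall>p. val W p \<subseteq> nodes W \<and> (\<forall>k\<in>val W p. \<forall>l\<in>nodes W. (k, l) \<in> le W \<longrightarrow> l \<in> val W p))"

definition immediate_successors :: "'k set \<Rightarrow> 'k rel \<Rightarrow> 'k \<Rightarrow> 'k set" where
  "immediate_successors K R k =
     {l\<in>K. (k, l) \<in> R \<and> l \<noteq> k \<and> (\<forall>m\<in>K. (k, m) \<in> R \<and> (m, l) \<in> R \<longrightarrow> m = k \<or> m = l)}"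

definition finitely_branching :: "'k set \<Rightarrow> 'k rel \<Rightarrow> bool" where
  "finitely_branching K R \<longleftrightarrow> (\<forall>k\<in>K. finite (immediate_successors K R k))"

definition branch :: "'k set \<Rightarrow> 'k rel \<Rightarrow> 'k set \<Rightarrow> bool" where
  "branch K R B \<longleftrightarrow> pred_on.maxchain K (\<lambda>x y. (x, y) \<in> R) B"

definition sf_model :: "('k, 'p) model \<Rightarrow> bool" where
  "sf_model W \<longleftrightarrow>
     int_model W \<and>
     finitely_branching (nodes W) (le W) \<and>
     (\<forall>B. branch (nodes W) (le W) B \<longrightarrow> countable B) \<and>
     (\<forall>k\<in>nodes W. finite {p. k \<in> val W p}) \<and>
     (\<forall>p. (\<exists>k\<in>nodes W. k \<in> val W p) \<longrightarrow>
          (\<forall>l\<in>nodes W. \<exists>l'\<in>nodes W. (l, l') \<in> le W \<and> l' \<in> val W p))"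


section \<open>Forcing and semantic consequence\<close>

primrec forces :: "('k, 'p) model \<Rightarrow> 'k \<Rightarrow> 'p form \<Rightarrow> bool" where
  "forces W k \<^bold>\<bottom> \<longleftrightarrow> False"
| "forces W k (Var p) \<longleftrightarrow> k \<in> val W p"
| "forces W k (A \<^bold>\<and> B) \<longleftrightarrow> forces W k A \<and> forces W k B"
| "forces W k (A \<^bold>\<or> B) \<longleftrightarrow> forces W k A \<or> forces W k B"
| "forces W k (A \<^bold>\<rightarrow> B) \<longleftrightarrow>
     (\<forall>k'\<in>nodes W. (k, k') \<in> le W \<and> forces W k' A \<longrightarrow>
        (\<exists>k''\<in>nodes W. (k', k'') \<in> le W \<and> forces W k'' B))"

definition consequence_in ::
    "('k, 'p::countable) model \<Rightarrow> 'p form list \<Rightarrow> 'p form list \<Rightarrow> bool" where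
  "consequence_in W \<Gamma> \<Delta> \<longleftrightarrow>
     (\<forall>k\<in>nodes W. (\<forall>A\<in>set \<Gamma>. forces W k A) \<longrightarrow> (\<exists>B\<in>set \<Delta>. forces W k B))"

text \<open>
  HOL has no quantification over types inside a formula, so the class of all models is represented
  by the models whose nodes are drawn from a type \<open>'k\<close>, passed as a type argument. A theorem whose
  conclusion is stated for a free \<open>'k\<close> covers models over every type.
\<close>

definition sf_consequence ::
    "'k itself \<Rightarrow> 'p::countable form list \<Rightarrow> 'p form list \<Rightarrow> bool" where
  "sf_consequence T \<Gamma> \<Delta> \<longleftrightarrow> (\<forall>W :: ('k, 'p) model. sf_model W \<longrightarrow> consequence_in W \<Gamma> \<Delta>)"


section \<open>The sequent calculus\<close>

abbreviation nn :: "'p form list \<Rightarrow> 'p form list" where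
  "nn \<Gamma> \<equiv> map NegNeg \<Gamma>"

inductive SF :: "'p form list \<Rightarrow> 'p form list \<Rightarrow> bool"  (infix "\<turnstile>\<^sub>S\<^sub>F" 50) where
  init_bot: "[\<^bold>\<bottom>] \<turnstile>\<^sub>S\<^sub>F []"
| init_var: "[Var p] \<turnstile>\<^sub>S\<^sub>F [Var p]"
| weakL: "\<Gamma> \<turnstile>\<^sub>S\<^sub>F \<Delta> \<Longrightarrow> A # \<Gamma> \<turnstile>\<^sub>S\<^sub>F \<Delta>"
| weakR: "\<Gamma> \<turnstile>\<^sub>S\<^sub>F \<Delta> \<Longrightarrow> \<Gamma> \<turnstile>\<^sub>S\<^sub>F \<Delta> @ [A]"
| contrL: "A # A # \<Gamma> \<turnstile>\<^sub>S\<^sub>F \<Delta> \<Longrightarrow> A # \<Gamma> \<turnstile>\<^sub>S\<^sub>F \<Delta>"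
| contrR: "\<Gamma> \<turnstile>\<^sub>S\<^sub>F \<Delta> @ [A, A] \<Longrightarrow> \<Gamma> \<turnstile>\<^sub>S\<^sub>F \<Delta> @ [A]"
| exchL: "\<Gamma> @ [A, B] @ \<Pi> \<turnstile>\<^sub>S\<^sub>F \<Delta> \<Longrightarrow> \<Gamma> @ [B, A] @ \<Pi> \<turnstile>\<^sub>S\<^sub>F \<Delta>"
| exchR: "\<Gamma> \<turnstile>\<^sub>S\<^sub>F \<Delta> @ [A, B] @ \<Sigma> \<Longrightarrow> \<Gamma> \<turnstile>\<^sub>S\<^sub>F \<Delta> @ [B, A] @ \<Sigma>"
| cut: "\<Gamma> \<turnstile>\<^sub>S\<^sub>F \<Delta> @ [A] \<Longrightarrow> A # \<Pi> \<turnstile>\<^sub>S\<^sub>F \<Sigma> \<Longrightarrow> \<Gamma> @ \<Pi> \<turnstile>\<^sub>S\<^sub>F \<Delta> @ \<Sigma>"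
| conjL1: "A # \<Gamma> \<turnstile>\<^sub>S\<^sub>F \<Delta> \<Longrightarrow> (B \<^bold>\<and> A) # \<Gamma> \<turnstile>\<^sub>S\<^sub>F \<Delta>"
| conjL2: "A # \<Gamma> \<turnstile>\<^sub>S\<^sub>F \<Delta> \<Longrightarrow> (A \<^bold>\<and> B) # \<Gamma> \<turnstile>\<^sub>S\<^sub>F \<Delta>"
| conjR: "\<Gamma> \<turnstile>\<^sub>S\<^sub>F \<Delta> @ [A] \<Longrightarrow> \<Gamma> \<turnstile>\<^sub>S\<^sub>F \<Delta> @ [B] \<Longrightarrow> \<Gamma> \<turnstile>\<^sub>S\<^sub>F \<Delta> @ [A \<^bold>\<and> B]"
| disjL: "A # \<Gamma> \<turnstile>\<^sub>S\<^sub>F \<Delta> \<Longrightarrow> B # \<Gamma> \<turnstile>\<^sub>S\<^sub>F \<Delta> \<Longrightarrow> (A \<^bold>\<or> B) # \<Gamma> \<turnstile>\<^sub>S\<^sub>F \<Delta>"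
| disjR1: "\<Gamma> \<turnstile>\<^sub>S\<^sub>F \<Delta> @ [A] \<Longrightarrow> \<Gamma> \<turnstile>\<^sub>S\<^sub>F \<Delta> @ [A \<^bold>\<or> B]"
| disjR2: "\<Gamma> \<turnstile>\<^sub>S\<^sub>F \<Delta> @ [A] \<Longrightarrow> \<Gamma> \<turnstile>\<^sub>S\<^sub>F \<Delta> @ [B \<^bold>\<or> A]"
| impL: "\<Gamma> \<turnstile>\<^sub>S\<^sub>F \<Delta> @ [A] \<Longrightarrow> B # \<Pi> \<turnstile>\<^sub>S\<^sub>F \<Sigma> \<Longrightarrow> \<Gamma> @ (A \<^bold>\<rightarrow> B) # \<Pi> \<turnstile>\<^sub>S\<^sub>F \<Delta> @ nn \<Sigma>"
| impR: "\<Gamma> @ [A] \<turnstile>\<^sub>S\<^sub>F \<^bold>\<not>\<^bold>\<not> B # \<Delta> \<Longrightarrow> \<Gamma> \<turnstile>\<^sub>S\<^sub>F (A \<^bold>\<rightarrow> B) # nn \<Delta>"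

end

theory Submission
  imports Defs
begin

text \<open>
  In a strict finitistic model, clause (4) on valuations lifts to all formulas: a formula forced at
  some node is forced above every node. Hence \<open>\<^bold>\<not>\<^bold>\<not> A\<close> is forced at a node iff \<open>A\<close> is forced
  somewhere in the model, and \<open>A \<^bold>\<rightarrow> B\<close> iff \<open>B\<close> is forced somewhere or \<open>A\<close> nowhere. The implication rules
  have to pass to a later node, where only some side formula on the right is known to be forced;
  its double negation is then forced at the original node.
\<close>

locale strict_finitistic_model =
  fixes W :: "('k, 'p) model"
  assumes sf: "sf_model W"
begin

lemma le_refl: "k \<in> nodes W \<Longrightarrow> (k, k) \<in> le W"
  using sf
  by (auto simp: sf_model_def int_model_def int_frame_def partial_order_on_def preorder_on_def
      dest: refl_onD)

lemma le_trans: "(k, l) \<in> le W \<Longrightarrow> (l, m) \<in> le W \<Longrightarrow> (k, m) \<in> le W"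
  using sf
  by (auto simp: sf_model_def int_model_def int_frame_def partial_order_on_def preorder_on_def
      dest: transD)

lemma forces_mono:
  "forces W k A \<Longrightarrow> (k, l) \<in> le W \<Longrightarrow> l \<in> nodes W \<Longrightarrow> forces W l A"
proof (induction A)
  case (Var p)
  then show ?case
    using sf by (auto simp: sf_model_def int_model_def)
next
  case (Imp A B)
  then show ?case
    by (auto intro: le_trans)
qed auto

lemma forces_dense:
  assumes "k \<in> nodes W" "forces W k A" "l \<in> nodes W"
  shows "\<exists>l'\<in>nodes W. (l, l') \<in> le W \<and> forces W l' A"
  using assms
proof (induction A arbitrary: k l)
  case (Var p)
  then show ?case
    using sf by (auto simp: sf_model_def)
next
  case (Conj A B)
  \<comment> \<open>The node for \<open>B\<close> is sought above the one for \<open>A\<close>, so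
    that persistence keeps \<open>A\<close> forced there.\<close>
  from Conj.IH(1)[of k l] Conj.prems obtain m
    where m: "m \<in> nodes W" "(l, m) \<in> le W" "forces W m A"
    by auto
  from Conj.IH(2)[of k m] Conj.prems m obtain n
    where n: "n \<in> nodes W" "(m, n) \<in> le W" "forces W n B"
    by auto
  from m n show ?case
    by (auto intro: le_trans forces_mono)
next
  case (Disj A B)
  then show ?case
    by (metis forces.simps(4))
next
  case (Imp A B)
  \<comment> \<open>The witness is \<open>l\<close> itself, even if unrelated to \<open>k\<close>:
    \<open>A\<close> at \<open>l'\<close> recurs above \<open>k\<close>, where the implication
    yields \<open>B\<close>, and \<open>B\<close> then recurs above \<open>l'\<close>.\<close>
  have "forces W l (A \<^bold>\<rightarrow> B)"
    unfolding forces.simps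
  proof (intro ballI impI)
    fix l' assume l': "l' \<in> nodes W" "(l, l') \<in> le W \<and> forces W l' A"
    with Imp.IH(1)[of l' k] Imp.prems obtain n where "n \<in> nodes W" "forces W n B"
      by auto
    then show "\<exists>l''\<in>nodes W. (l', l'') \<in> le W \<and> forces W l'' B"
      using Imp.IH(2) l' by blast
  qed
  with Imp.prems show ?case
    using le_refl by blast
qed simp

text \<open>By \<open>forces_dense\<close>, forced somewhere and forced above a given node amount to
  the same, so an implication has one truth value throughout the model.\<close>

lemma forces_Imp_iff:
  assumes "k \<in> nodes W"
  shows "forces W k (A \<^bold>\<rightarrow> B) \<longleftrightarrow>
    ((\<exists>l\<in>nodes W. forces W l A) \<longrightarrow> (\<exists>l\<in>nodes W. forces W l B))"
  using assms forces_dense unfolding forces.simps by meson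

lemma forces_NegNeg_iff:
  assumes "k \<in> nodes W"
  shows "forces W k (\<^bold>\<not>\<^bold>\<not> A) \<longleftrightarrow> (\<exists>l\<in>nodes W. forces W l A)"
  using assms by (auto simp: forces_Imp_iff simp del: forces.simps(5))

end

lemma SF_sound:
  fixes W :: "('k, 'p::countable) model"
  assumes "\<Gamma> \<turnstile>\<^sub>S\<^sub>F \<Delta>" "sf_model W"
  shows "consequence_in W \<Gamma> \<Delta>"
proof -
  interpret strict_finitistic_model W
    by unfold_locales (fact assms(2))
  note Imp_iff = forces_Imp_iff forces_NegNeg_iff
  from assms(1) show ?thesis
  proof induction
    case (cut \<Gamma> \<Delta> A \<Pi> \<Sigma>)
    then show ?case
      unfolding consequence_in_def by (simp add: ball_Un bex_Un) blast
  next
    case (impL \<Gamma> \<Delta> A B \<Pi> \<Sigma>)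
    show ?case
      unfolding consequence_in_def
    proof (intro ballI impI)
      fix k assume k: "k \<in> nodes W" and \<Gamma>: "\<forall>C\<in>set (\<Gamma> @ (A \<^bold>\<rightarrow> B) # \<Pi>). forces W k C"
      show "\<exists>C\<in>set (\<Delta> @ nn \<Sigma>). forces W k C"
      proof (cases "\<exists>C\<in>set \<Delta>. forces W k C")
        case False
        with impL.IH(1) k \<Gamma> have "forces W k A"
          by (auto simp: consequence_in_def)
        \<comment> \<open>Reflexivity lets \<open>k\<close> serve as the node forcing
          \<open>A\<close>. The right premise is then used at \<open>l\<close>, where
          \<open>\<Pi>\<close> persists.\<close>
        with k \<Gamma> obtain l where l: "l \<in> nodes W" "(k, l) \<in> le W" "forces W l B"
          using le_refl by auto
        with \<Gamma> have "\<forall>C\<in>set (B # \<Pi>). forces W l C"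
          by (auto intro: forces_mono)
        with impL.IH(2) l(1) obtain C where "C \<in> set \<Sigma>" "forces W l C"
          by (auto simp: consequence_in_def)
        with k l(1) have "forces W k (\<^bold>\<not>\<^bold>\<not> C)"
          by (auto simp: Imp_iff simp del: forces.simps)
        with \<open>C \<in> set \<Sigma>\<close> show ?thesis
          by (auto simp del: forces.simps)
      qed auto
    qed
  next
    case (impR \<Gamma> A B \<Delta>)
    show ?case
      unfolding consequence_in_def
    proof (intro ballI impI)
      fix k assume k: "k \<in> nodes W" and \<Gamma>: "\<forall>C\<in>set \<Gamma>. forces W k C"
      show "\<exists>C\<in>set ((A \<^bold>\<rightarrow> B) # nn \<Delta>). forces W k C"
      proof (cases "forces W k (A \<^bold>\<rightarrow> B)")
        case False
        \<comment> \<open>This will exclude the double negation of \<open>B\<close> at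
          \<open>l\<close>, leaving only a member of \<open>\<Delta>\<close> to be forced
          there.\<close>
        then have noB: "\<forall>m\<in>nodes W. \<not> forces W m B"
          using k by (auto simp: Imp_iff simp del: forces.simps)
        \<comment> \<open>The node comes from the forcing clause rather than from
          \<open>forces_Imp_iff\<close>, because it must lie above \<open>k\<close> for
          \<open>\<Gamma>\<close> to persist.\<close>
        from False obtain l where l: "l \<in> nodes W" "(k, l) \<in> le W" "forces W l A"
          by auto
        with \<Gamma> have "\<forall>C\<in>set (\<Gamma> @ [A]). forces W l C"
          by (auto intro: forces_mono)
        with impR.IH l(1) have "\<exists>C\<in>set (\<^bold>\<not>\<^bold>\<not> B # \<Delta>). forces W l C"
          unfolding consequence_in_def by blast
        moreover from noB l(1) have "\<not> forces W l (\<^bold>\<not>\<^bold>\<not> B)"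
          using forces_NegNeg_iff by blast
        ultimately obtain C where C: "C \<in> set \<Delta>" "forces W l C"
          by (auto simp del: forces.simps)
        with k l(1) have "forces W k (\<^bold>\<not>\<^bold>\<not> C)"
          by (auto simp: Imp_iff simp del: forces.simps)
        with C(1) show ?thesis
          by (auto simp del: forces.simps)
      qed simp
    qed
  \<comment> \<open>In the remaining rules premises and conclusion are compared at one and the same
    node.\<close>
  qed (fastforce simp: consequence_in_def)+
qed

theorem proposition16:
  fixes \<Gamma> \<Delta> :: "'p::countable form list"
  assumes "\<Gamma> \<turnstile>\<^sub>S\<^sub>F \<Delta>"
  shows "sf_consequence TYPE('k) \<Gamma> \<Delta>"
  unfolding sf_consequence_def by (intro allI impI SF_sound assms)

end
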